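(* Let $\alpha<1$ be a real constant. There exists an almost periodic infinite binary sequence $\omega=\omega_0\omega_1\omega_2\ldots$ such that any sufficiently long substring $x$ of $\omega$ has large complexity: there is a number $N$ such that every substring $x$ of $\omega$ with $|x|>N$ satisfies $\mathrm{K}(x)\ge\alpha|x|$.
   Context: A substring of $\omega$ is a finite string of consecutive terms of $\omega$; $|x|$ is the length of the string $x$. A sequence $\omega$ is called almost periodic if each of its substrings has infinitely many occurrences at limited distances, i.e. for any substring $x$ of $\omega$ there exists a number $k$ such that any substring $y$ of $\omega$ of length $k$ contains $x$ as a substring. $\mathrm{K}(x)$ is the Kolmogorov complexity of the binary string $x$, i.e. the length of a shortest program producing $x$ with respect to a fixed optimal (universal) machine; it does not matter which version (plain, prefix, etc.) is used. *)

theory Defs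
  imports
    Complex_Main
    "HOL-Library.Sublist"
    "HOL-Library.Omega_Words_Fun"
    "HOL-Library.Extended_Nat"
    "HOL-Library.Extended_Real"
begin

subsection \<open>Almost periodic sequences\<close>

definition substring_of :: "'a list \<Rightarrow> 'a word \<Rightarrow> bool" where
  "substring_of x w \<longleftrightarrow> (\<exists>i j. x = subsequence w i j)"

definition almost_periodic :: "'a word \<Rightarrow> bool" where
  "almost_periodic w \<longleftrightarrow>
     (\<forall>x. substring_of x w \<longrightarrow>
        (\<exists>k. \<forall>y. substring_of y w \<and> length y = k \<longrightarrow> sublist x y))"


subsection \<open>Partial recursive functions\<close>

datatype recf = Zero | Succ | Proj nat | Comp recf "recf list" | PrimRec recf recf | Mu recf

text \<open>
  Arities are not tracked: codes are evaluated on argument lists of any length; surplus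
  arguments are ignored, and reading a missing one is undefined. In \<open>PrimRec\<close> and \<open>Mu\<close> the recursion variable and the search variable
  come first. The search of \<open>Mu\<close> succeeds only if all smaller candidates have a defined,
  nonzero value.
\<close>

inductive rec_eval :: "recf \<Rightarrow> nat list \<Rightarrow> nat \<Rightarrow> bool" where
  Zero: "rec_eval Zero xs 0"
| Succ: "rec_eval Succ (x # xs) (Suc x)"
| Proj: "i < length xs \<Longrightarrow> rec_eval (Proj i) xs (xs ! i)"
| Comp: "list_all2 (\<lambda>g y. rec_eval g xs y) gs ys \<Longrightarrow> rec_eval f ys z \<Longrightarrow>
           rec_eval (Comp f gs) xs z"
| PrimRec_0: "rec_eval f xs y \<Longrightarrow> rec_eval (PrimRec f g) (0 # xs) y"
| PrimRec_Suc: "rec_eval (PrimRec f g) (n # xs) y \<Longrightarrow> rec_eval g (n # y # xs) z \<Longrightarrow>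
           rec_eval (PrimRec f g) (Suc n # xs) z"
| Mu: "rec_eval f (n # xs) 0 \<Longrightarrow> (\<forall>m<n. \<exists>y. rec_eval f (m # xs) (Suc y)) \<Longrightarrow>
           rec_eval (Mu f) xs n"

lemma rec_eval_deterministic: "rec_eval f xs y \<Longrightarrow> rec_eval f xs z \<Longrightarrow> y = z"
proof (induction arbitrary: z rule: rec_eval.induct)
  case (Comp xs gs ys f z z')
  from Comp.prems obtain ys' where ys': "list_all2 (\<lambda>g y. rec_eval g xs y) gs ys'"
    and z': "rec_eval f ys' z'"
    by (cases rule: rec_eval.cases) auto
  have "ys = ys'"
    using Comp.IH(1) ys' by (auto simp: list_all2_conv_all_nth intro!: nth_equalityI)
  with z' Comp.IH(2) show ?case by blast
next
  case (PrimRec_Suc f g n xs y z z')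
  from PrimRec_Suc.prems show ?case
    by (cases rule: rec_eval.cases) (use PrimRec_Suc.IH in blast)
next
  case (Mu f n xs z)
  from Mu.prems obtain *: "rec_eval f (z # xs) 0"
    and **: "\<forall>m<z. \<exists>y. rec_eval f (m # xs) (Suc y)"
    by (cases rule: rec_eval.cases) auto
  show ?case
  proof (cases n z rule: linorder_cases)
    case less
    then obtain y where "rec_eval f (n # xs) (Suc y)" using ** by blast
    with Mu.IH(1) show ?thesis by blast
  next
    case greater
    then obtain y where "\<And>w. rec_eval f (z # xs) w \<Longrightarrow> Suc y = w" using Mu.IH(2) by blast
    with * show ?thesis by blast
  qed
next
  case (PrimRec_0 f xs y g z)
  from PrimRec_0.prems show ?case
    by (cases rule: rec_eval.cases) (use PrimRec_0.IH in blast)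
qed (erule rec_eval.cases; simp)+


subsection \<open>Kolmogorov complexity\<close>

text \<open>Bijective base-2 numeration: a computable bijection between strings and numbers.\<close>

primrec string_code :: "bool list \<Rightarrow> nat" where
  "string_code [] = 0"
| "string_code (b # p) = 2 * string_code p + (if b then 2 else 1)"

lemma bij_string_code: "bij string_code"
proof (rule bijI)
  have "string_code p = string_code q \<Longrightarrow> p = q" for p q
  proof (induction p arbitrary: q)
    case Nil
    then show ?case by (cases q) (auto split: if_splits)
  next
    case (Cons b p)
    then obtain c q' where q: "q = c # q'" by (cases q) (auto split: if_splits)
    have "b = c" using Cons.prems unfolding q by (cases b; cases c) (simp_all, presburger+)
    then show ?case using Cons q by (auto split: if_splits)
  qed
  then show "inj string_code" by (rule injI)
  have "\<exists>p. string_code p = n" for n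
  proof (induction n rule: less_induct)
    case (less n)
    consider "n = 0" | m where "n = 2 * m + 1" | m where "n = 2 * m + 2"
    proof (cases "n = 0 \<or> odd n")
      case True
      then show ?thesis using that(1,2) by (auto elim: oddE)
    next
      case False
      then obtain k where "n = 2 * k" "k \<noteq> 0" by (auto elim: evenE)
      then have "n = 2 * (k - 1) + 2" by simp
      then show ?thesis by (rule that(3))
    qed
    then show ?case
    proof cases
      case 1
      then show ?thesis by (metis string_code.simps(1))
    next
      case (2 m)
      then obtain p where "string_code p = m" using less.IH[of m] by auto
      then have "string_code (False # p) = n" using 2 by simp
      then show ?thesis by blast
    next
      case (3 m)
      then obtain p where "string_code p = m" using less.IH[of m] by auto
      then have "string_code (True # p) = n" using 3 by simp
      then show ?thesis by blast
    qed
  qed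
  then show "surj string_code" unfolding surj_def by metis
qed

type_synonym machine = "bool list \<Rightarrow> bool list option"

definition computable_machines :: "machine set" where
  "computable_machines =
     {U. \<exists>f. \<forall>p x. U p = Some x \<longleftrightarrow> rec_eval f [string_code p] (string_code x)}"

definition prefix_free_machines :: "machine set" where
  "prefix_free_machines =
     {U \<in> computable_machines. \<forall>p\<in>dom U. \<forall>q\<in>dom U. \<not> strict_prefix p q}"

definition optimal_in :: "machine set \<Rightarrow> machine \<Rightarrow> bool" where
  "optimal_in M U \<longleftrightarrow> U \<in> M \<and>
     (\<forall>V\<in>M. \<exists>c. \<forall>p x. V p = Some x \<longrightarrow>
        (\<exists>q. U q = Some x \<and> length q \<le> length p + c))"

text \<open>
  The infimum is a minimum when \<open>x\<close> has a description; otherwise it is \<open>\<infinity>\<close>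
  (which does not happen for optimal machines).
\<close>

definition Kolmogorov :: "machine \<Rightarrow> bool list \<Rightarrow> enat" where
  "Kolmogorov U x = (INF p \<in> {p. U p = Some x}. enat (length p))"

end

theory Submission
  imports Defs "HOL-Library.Cardinality"
begin

text \<open>
  Only a counting property of complexity matters: fewer than $2^m$ strings have a description
  shorter than $m$, so the compressible strings are sparse in every length. A one-letter extension
  of a word avoiding them either avoids them as well or ends in a compressible string preceded by
  a shorter avoiding word. The resulting recurrence shows that the number of avoiding words grows
  exponentially, provided only compressible strings longer than some $N$ are forbidden.
  By compactness, Zorn's lemma extends the forbidden strings to a maximal set $S$ that is still
  avoidable, and some infinite word $w$ avoids $S$. If $u$ occurs in $w$, then $u$ is not in $S$,
  so by maximality $u$ cannot be forbidden in addition: for some $k$ all words of length $k$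
  that avoid $S$, in particular all substrings of $w$ of length $k$, contain $u$.
\<close>

definition avoiding :: "'a list set \<Rightarrow> 'a list set" where
  "avoiding S = {w. \<forall>u\<in>S. \<not> sublist u w}"

text \<open>Phrased through finite words of each length, not an infinite word, so that failure means
  some single length admits no avoiding word.\<close>

definition avoidable :: "'a list set \<Rightarrow> bool" where
  "avoidable S \<longleftrightarrow> (\<forall>n. \<exists>w\<in>avoiding S. length w = n)"

lemma avoiding_sublist: "w \<in> avoiding S \<Longrightarrow> sublist v w \<Longrightarrow> v \<in> avoiding S"
  unfolding avoiding_def using sublist_order.order.trans by blast

lemma finite_lists_length: "finite {w :: 'a::finite list. length w = n}"
  using finite_lists_length_eq[of "UNIV :: 'a set" n] by simp

lemma finite_lists_length_less: "finite {w :: 'a::finite list. length w < n}"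
proof -
  have "{w :: 'a list. length w < n} \<subseteq> {w. set w \<subseteq> UNIV \<and> length w \<le> n}" by auto
  then show ?thesis using finite_lists_length_le[of "UNIV :: 'a set" n] by (rule finite_subset) simp
qed

subsection \<open>Growth of the number of avoiding words\<close>

text \<open>Append every letter to every avoiding word of length \<open>n\<close>. An extension that
  stops avoiding \<open>S\<close> splits as \<open>p @ u\<close> with \<open>u\<close> in
  \<open>S\<close> of length \<open>Suc i\<close> and \<open>p\<close> avoiding of length
  \<open>n - i\<close>, so the pairs \<open>(p, u)\<close> bound the number of lost
  extensions.\<close>

lemma card_avoiding_extensions:
  fixes S :: "'a::finite list set"
  assumes "[] \<notin> S"
  defines "a \<equiv> \<lambda>n. card {w \<in> avoiding S. length w = n}"
  defines "s \<equiv> \<lambda>n. card {u \<in> S. length u = n}"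
  shows "a n * CARD('a) \<le> a (Suc n) + (\<Sum>i\<le>n. a (n - i) * s (Suc i))"
proof -
  define A where "A n = {w \<in> avoiding S. length w = n}" for n
  define B where "B n = {u \<in> S. length u = n}" for n
  define E where "E = (\<lambda>(w, c). w @ [c]) ` (A n \<times> UNIV)"
  define D where "D i = (\<lambda>(w, u). w @ u) ` (A (n - i) \<times> B (Suc i))" for i
  have finA: "finite (A m)" and finB: "finite (B m)" for m
    unfolding A_def B_def by (auto intro: finite_subset[OF _ finite_lists_length[of m]])
  have "E \<subseteq> A (Suc n) \<union> (\<Union>i\<le>n. D i)"
  proof
    fix x assume "x \<in> E"
    then obtain w c where w: "w \<in> avoiding S" "length w = n" and x: "x = w @ [c]"
      by (auto simp: E_def A_def)
    show "x \<in> A (Suc n) \<union> (\<Union>i\<le>n. D i)"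
    proof (cases "x \<in> avoiding S")
      case True
      then show ?thesis using w x by (simp add: A_def)
    next
      case False
      then obtain u where u: "u \<in> S" "sublist u x" by (auto simp: avoiding_def)
      then obtain p q where pq: "w @ [c] = p @ u @ q" using x by (auto simp: sublist_def)
      \<comment> \<open>A forbidden factor that misses the new last letter would already occur in
        \<open>w\<close>.\<close>
      have "q = []"
      proof (rule ccontr)
        assume "q \<noteq> []"
        then obtain q' where "w = p @ u @ q'"
          using pq by (cases q rule: rev_cases) auto
        then show False using w(1) u(1) by (auto simp: avoiding_def)
      qed
      moreover have "u \<noteq> []" using u(1) assms(1) by blast
      ultimately obtain v where v: "u = v @ [c]" "w = p @ v"
        using pq by (cases u rule: rev_cases) auto
      have "p \<in> avoiding S" using w(1) v(2) by (auto intro: avoiding_sublist)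
      then have "x \<in> D (length v)"
        using u(1) v w x unfolding D_def A_def B_def by (auto intro!: image_eqI[of _ _ "(p, u)"])
      then show ?thesis using v w by auto
    qed
  qed
  moreover have "finite (A (Suc n) \<union> (\<Union>i\<le>n. D i))"
    using finA finB by (auto simp: D_def)
  ultimately have "card E \<le> card (A (Suc n) \<union> (\<Union>i\<le>n. D i))" by (rule card_mono[rotated])
  also have "\<dots> \<le> card (A (Suc n)) + card (\<Union>i\<le>n. D i)" by (rule card_Un_le)
  also have "card (\<Union>i\<le>n. D i) \<le> (\<Sum>i\<le>n. card (D i))" by (rule card_UN_le) simp
  also have "(\<Sum>i\<le>n. card (D i)) \<le> (\<Sum>i\<le>n. card (A (n - i)) * card (B (Suc i)))"
    unfolding D_def card_cartesian_product[symmetric]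
    by (intro sum_mono card_image_le finite_cartesian_product finA finB)
  also have "card E = card (A n) * CARD('a)"
    unfolding E_def by (subst card_image) (auto simp: inj_on_def card_cartesian_product)
  finally show ?thesis by (simp add: a_def s_def A_def B_def)
qed

text \<open>Strong induction: growth by the factor \<open>\<beta>\<close> at all smaller lengths
  gives \<open>a (n - i) \<le> a n / \<beta> ^ i\<close>. The losses in the recurrence are then at
  most \<open>a n * (CARD('a) - \<beta>)\<close>, which leaves at least \<open>\<beta> * a n\<close>
  words.\<close>

lemma card_avoiding_growth:
  fixes S :: "'a::finite list set" and \<beta> :: real
  assumes "[] \<notin> S" and "\<beta> > 0"
    and sparse: "\<And>n. (\<Sum>i<n. real (card {u \<in> S. length u = Suc i}) / \<beta> ^ i) \<le> real CARD('a) - \<beta>"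
  shows "\<beta> * real (card {w \<in> avoiding S. length w = n})
           \<le> real (card {w \<in> avoiding S. length w = Suc n})"
proof (induction n rule: less_induct)
  case (less n)
  define a where "a n = card {w \<in> avoiding S. length w = n}" for n
  define s where "s n = card {u \<in> S. length u = n}" for n
  have IH: "\<beta> * real (a m) \<le> real (a (Suc m))" if "m < n" for m
    using less.IH[OF that] by (simp add: a_def)
  have growth: "\<beta> ^ i * real (a (n - i)) \<le> real (a n)" if "i \<le> n" for i
    using that
  proof (induction i)
    case 0
    show ?case by simp
  next
    case (Suc i)
    have "\<beta> * real (a (n - Suc i)) \<le> real (a (n - i))"
      using IH[of "n - Suc i"] Suc.prems by (simp add: Suc_diff_Suc)
    then have "\<beta> ^ i * (\<beta> * real (a (n - Suc i))) \<le> \<beta> ^ i * real (a (n - i))"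
      using \<open>\<beta> > 0\<close> by (intro mult_left_mono) auto
    then show ?case using Suc by (simp add: mult_ac)
  qed
  have "real (\<Sum>i\<le>n. a (n - i) * s (Suc i)) \<le> (\<Sum>i\<le>n. real (a n) * (real (s (Suc i)) / \<beta> ^ i))"
    unfolding of_nat_sum of_nat_mult
  proof (rule sum_mono)
    fix i assume "i \<in> {..n}"
    then have "real (a (n - i)) \<le> real (a n) / \<beta> ^ i"
      using growth[of i] \<open>\<beta> > 0\<close> by (simp add: field_simps)
    then have "real (a (n - i)) * real (s (Suc i)) \<le> real (a n) / \<beta> ^ i * real (s (Suc i))"
      by (rule mult_right_mono) simp
    then show "real (a (n - i)) * real (s (Suc i)) \<le> real (a n) * (real (s (Suc i)) / \<beta> ^ i)"
      by simp
  qed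
  also have "\<dots> = real (a n) * (\<Sum>i<Suc n. real (s (Suc i)) / \<beta> ^ i)"
    by (simp only: sum_distrib_left lessThan_Suc_atMost)
  also have "\<dots> \<le> real (a n) * (real CARD('a) - \<beta>)"
    using sparse[of "Suc n"] by (intro mult_left_mono) (simp_all only: s_def of_nat_0_le_iff)
  finally have *: "real (\<Sum>i\<le>n. a (n - i) * s (Suc i)) \<le> real (a n) * (real CARD('a) - \<beta>)" .
  have "real (a n * CARD('a)) \<le> real (a (Suc n) + (\<Sum>i\<le>n. a (n - i) * s (Suc i)))"
    unfolding of_nat_le_iff a_def s_def by (rule card_avoiding_extensions[OF assms(1)])
  then have "real (a n) * real CARD('a)
      \<le> real (a (Suc n)) + real (\<Sum>i\<le>n. a (n - i) * s (Suc i))"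
    by (simp only: of_nat_add of_nat_mult)
  with * have "\<beta> * real (a n) \<le> real (a (Suc n))"
    by (simp only: right_diff_distrib) (simp add: mult_ac)
  then show ?case by (simp add: a_def)
qed

lemma avoidable_if_sparse:
  fixes S :: "'a::finite list set" and \<beta> :: real
  assumes "[] \<notin> S" and "\<beta> > 0"
    and sparse: "\<And>n. (\<Sum>i<n. real (card {u \<in> S. length u = Suc i}) / \<beta> ^ i) \<le> real CARD('a) - \<beta>"
  shows "avoidable S"
proof -
  have "card {w \<in> avoiding S. length w = n} > 0" for n
  proof (induction n)
    case 0
    have "{w \<in> avoiding S. length w = 0} = {[]}"
      using assms(1) by (auto simp: avoiding_def)
    then show ?case by simp
  next
    case (Suc n)
    then have "0 < \<beta> * real (card {w \<in> avoiding S. length w = n})" using \<open>\<beta> > 0\<close> by simp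
    also note card_avoiding_growth[OF assms, of n]
    finally show ?case by simp
  qed
  then have "{w \<in> avoiding S. length w = n} \<noteq> {}" for n
    by (auto simp: card_gt_0_iff)
  then show ?thesis unfolding avoidable_def by blast
qed

subsection \<open>Compactness\<close>

text \<open>A word of length \<open>n\<close> can contain only forbidden words of length at most
  \<open>n\<close>. Over a finite alphabet these are finitely many, so one member of the chain
  already contains them all.\<close>

lemma avoidable_Union_chain:
  fixes \<C> :: "'a::finite list set set"
  assumes "subset.chain {S. avoidable S} \<C>" and "\<C> \<noteq> {}"
  shows "avoidable (\<Union>\<C>)"
  unfolding avoidable_def
proof
  fix n
  let ?T = "\<Union>\<C> \<inter> {w. length w < Suc n}"
  have "finite ?T" using finite_lists_length_less by blast
  then obtain S where S: "S \<in> \<C>" "?T \<subseteq> S"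
    using finite_subset_Union_chain[of ?T \<C> "{S. avoidable S}"] assms by auto
  then have "avoidable S" using assms(1) by (auto simp: subset.chain_def)
  then obtain w where w: "w \<in> avoiding S" "length w = n" unfolding avoidable_def by blast
  have "w \<in> avoiding (\<Union>\<C>)"
    unfolding avoiding_def
  proof (intro CollectI ballI notI)
    fix u assume u: "u \<in> \<Union>\<C>" "sublist u w"
    then have "u \<in> ?T" using sublist_length_le[OF u(2)] w(2) by auto
    then show False using S(2) u(2) w(1) unfolding avoiding_def by blast
  qed
  then show "\<exists>w\<in>avoiding (\<Union>\<C>). length w = n" using w(2) by blast
qed

lemma maximal_avoidable:
  fixes F :: "'a::finite list set"
  assumes "avoidable F"
  obtains S where "F \<subseteq> S" "avoidable S" "\<And>u. u \<notin> S \<Longrightarrow> \<not> avoidable (insert u S)"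
proof -
  let ?A = "{S. F \<subseteq> S \<and> avoidable S}"
  have "\<exists>M\<in>?A. \<forall>X\<in>?A. M \<subseteq> X \<longrightarrow> X = M"
  proof (rule subset_Zorn_nonempty)
    show "?A \<noteq> {}" using assms by blast
  next
    fix \<C> assume \<C>: "\<C> \<noteq> {}" "subset.chain ?A \<C>"
    then have "subset.chain {S. avoidable S} \<C>" by (auto simp: subset.chain_def)
    then have "avoidable (\<Union>\<C>)" using \<C>(1) by (rule avoidable_Union_chain)
    moreover have "F \<subseteq> \<Union>\<C>" using \<C> unfolding subset.chain_def by blast
    ultimately show "\<Union>\<C> \<in> ?A" by simp
  qed
  then obtain M where M: "F \<subseteq> M" "avoidable M"
    and max: "\<And>X. F \<subseteq> X \<Longrightarrow> avoidable X \<Longrightarrow> M \<subseteq> X \<Longrightarrow> X = M"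
    by auto
  have "\<not> avoidable (insert u M)" if "u \<notin> M" for u
    using max[of "insert u M"] M(1) that by blast
  with M show thesis by (rule that)
qed

text \<open>Koenig's lemma: a prefix with avoiding extensions of every length can be prolonged by a
  letter that keeps this property \<open>P\<close>.\<close>

lemma infinite_word_avoiding:
  fixes S :: "'a::finite list set"
  assumes "avoidable S"
  obtains w :: "'a word" where "\<And>x. substring_of x w \<Longrightarrow> x \<in> avoiding S"
proof -
  define P where "P x \<longleftrightarrow> (\<forall>n. \<exists>y. length y = n \<and> x @ y \<in> avoiding S)" for x
  have step: "\<exists>c. P (x @ [c])" if Px: "P x" for x
  proof (rule ccontr)
    assume "\<nexists>c. P (x @ [c])"
    then obtain f where f: "\<And>c y. length y = f c \<Longrightarrow> (x @ [c]) @ y \<notin> avoiding S"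
      unfolding P_def by metis
    \<comment> \<open>If every letter \<open>c\<close> fails at some length \<open>f c\<close>,
      finiteness of the alphabet bounds these lengths by \<open>m\<close>. An extension of length
      \<open>Suc m\<close> spends one letter on \<open>c\<close> and still leaves at least
      \<open>f c\<close> more, so truncating it contradicts the failure.\<close>
    define m where "m = Max (range f)"
    obtain y where y: "length y = Suc m" "x @ y \<in> avoiding S" using Px unfolding P_def by blast
    obtain c y' where cy: "y = c # y'" using y(1) by (cases y) auto
    have "f c \<le> length y'" using y(1) cy by (simp add: m_def)
    moreover have "(x @ [c]) @ take (f c) y' \<in> avoiding S"
    proof (rule avoiding_sublist[OF y(2)])
      have "x @ y = ((x @ [c]) @ take (f c) y') @ drop (f c) y'" using cy by simp
      then show "sublist ((x @ [c]) @ take (f c) y') (x @ y)" by (metis sublist_append_rightI)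
    qed
    ultimately show False using f[of "take (f c) y'" c] by simp
  qed
  define X where "X = rec_nat [] (\<lambda>_ x. x @ [SOME c. P (x @ [c])])"
  define w where "w n = (SOME c. P (X n @ [c]))" for n
  have X_Suc: "X (Suc n) = X n @ [w n]" for n by (simp add: X_def w_def)
  have X_map: "X n = map w [0..<n]" for n
    by (induction n) (simp_all add: X_Suc, simp add: X_def)
  have "P (X n)" for n
  proof (induction n)
    case 0
    show ?case using assms by (simp add: X_def P_def avoidable_def) blast
  next
    case (Suc n)
    show ?case unfolding X_Suc w_def by (rule someI_ex[OF step[OF Suc]])
  qed
  then have av: "map w [0..<n] \<in> avoiding S" for n
    unfolding X_map P_def using avoiding_sublist by blast
  have "x \<in> avoiding S" if sub: "substring_of x w" for x
  proof -
    obtain i j where x: "x = map w [i..<j]"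
      using sub by (auto simp: substring_of_def subsequence_def)
    have "sublist x (map w [0..<j])"
    proof (cases "i \<le> j")
      case True
      then have "map w [0..<j] = map w [0..<i] @ x"
        using upt_add_eq_append[of 0 i "j - i"] x by simp
      then show ?thesis by simp
    next
      \<comment> \<open>For \<open>j < i\<close> the substring is empty.\<close>
      case False
      then show ?thesis using x by simp
    qed
    then show ?thesis using av avoiding_sublist by blast
  qed
  then show thesis using that by blast
qed

lemma almost_periodic_avoiding:
  fixes F :: "'a::finite list set"
  assumes "avoidable F"
  obtains w :: "'a word" where "almost_periodic w" "\<And>x. substring_of x w \<Longrightarrow> x \<notin> F"
proof -
  obtain S where S: "F \<subseteq> S" "avoidable S" "\<And>u. u \<notin> S \<Longrightarrow> \<not> avoidable (insert u S)"
    using maximal_avoidable[OF assms] by blast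
  obtain w :: "'a word" where w: "\<And>x. substring_of x w \<Longrightarrow> x \<in> avoiding S"
    using infinite_word_avoiding[OF S(2)] by blast
  have notin: "x \<notin> S" if "substring_of x w" for x
    using w[OF that] by (auto simp: avoiding_def)
  have "almost_periodic w"
    unfolding almost_periodic_def
  proof (intro allI impI)
    fix x assume "substring_of x w"
    then have "\<not> avoidable (insert x S)" using notin S(3) by blast
    \<comment> \<open>The length at which avoidability fails serves as the window length of almost
      periodicity.\<close>
    then obtain k where "\<And>y. length y = k \<Longrightarrow> y \<notin> avoiding (insert x S)"
      unfolding avoidable_def by blast
    then show "\<exists>k. \<forall>y. substring_of y w \<and> length y = k \<longrightarrow> sublist x y"
      using w unfolding avoiding_def by blast
  qed
  then show thesis using that notin S(1) by blast
qed

subsection \<open>Counting compressible strings\<close>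

text \<open>A program describes at most one string, so it suffices to count the programs shorter
  than \<open>m\<close>.\<close>

lemma card_described:
  fixes U :: machine
  shows "card {x. \<exists>p. U p = Some x \<and> length p < m} \<le> 2 ^ m"
proof -
  have "card {p :: bool list. length p < m} \<le> 2 ^ m"
  proof (induction m)
    case (Suc m)
    have "{p :: bool list. length p < Suc m} = {p. length p < m} \<union> {p. length p = m}" by auto
    then have "card {p :: bool list. length p < Suc m}
        \<le> card {p :: bool list. length p < m} + card {p :: bool list. length p = m}"
      using card_Un_le by metis
    also have "card {p :: bool list. length p = m} = 2 ^ m"
      using card_lists_length_eq[of "UNIV :: bool set" m] by simp
    finally show ?case using Suc by simp
  qed simp
  moreover have "card {x. \<exists>p. U p = Some x \<and> length p < m} \<le> card {p :: bool list. length p < m}"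
  proof (rule surj_card_le[OF finite_lists_length_less])
    show "{x. \<exists>p. U p = Some x \<and> length p < m} \<subseteq> (the \<circ> U) ` {p. length p < m}"
      by force
  qed
  ultimately show ?thesis by linarith
qed

text \<open>At length \<open>Suc i\<close> there are at most \<open>2 * r ^ Suc i\<close>
  compressible strings, where \<open>r = 2 powr \<alpha> < 2\<close>. For \<open>\<beta>\<close>
  strictly between \<open>r\<close> and 2 the weighted counts are dominated by a geometric series of
  ratio \<open>q = r / \<beta> < 1\<close>, whose tail can be made small.\<close>

lemma avoidable_compressible:
  fixes U :: machine and \<alpha> :: real
  assumes "0 < \<alpha>" "\<alpha> < 1"
  obtains N where
    "avoidable {x. N < length x \<and> (\<exists>p. U p = Some x \<and> real (length p) < \<alpha> * real (length x))}"
proof -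
  define r where "r = 2 powr \<alpha>"
  have r: "0 < r" "r < 2"
    using assms powr_less_mono[of \<alpha> 1 2] by (auto simp: r_def)
  define \<beta> where "\<beta> = (r + 2) / 2"
  have \<beta>: "r < \<beta>" "\<beta> < 2" "0 < \<beta>" using r by (auto simp: \<beta>_def)
  define q where "q = r / \<beta>"
  have q: "0 < q" "q < 1" using r \<beta> by (auto simp: q_def)
  \<comment> \<open>The tail of the dominating series from index \<open>N\<close> on tends to 0, so
    some \<open>N\<close> brings it below the slack \<open>2 - \<beta>\<close> allowed for a
    two-letter alphabet.\<close>
  have "(\<lambda>N. 2 * r * (q ^ N / (1 - q))) \<longlonglongrightarrow> 2 * r * (0 / (1 - q))"
    using q by (intro tendsto_intros LIMSEQ_realpow_zero) auto
  then have "eventually (\<lambda>N. 2 * r * (q ^ N / (1 - q)) < 2 - \<beta>) sequentially"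
    using \<beta> by (intro order_tendstoD(2)) auto
  then obtain N where N: "2 * r * (q ^ N / (1 - q)) < 2 - \<beta>"
    by (auto simp: eventually_sequentially)
  define F where
    "F = {x. N < length x \<and> (\<exists>p. U p = Some x \<and> real (length p) < \<alpha> * real (length x))}"
  have bound: "real (card {u \<in> F. length u = Suc i}) / \<beta> ^ i \<le> 2 * r * q ^ i" for i
  proof -
    \<comment> \<open>For natural lengths, being below \<open>\<alpha> * real (Suc i)\<close> is the
      same as being below its ceiling; rounding up costs the factor 2 in the bound.\<close>
    define m where "m = nat \<lceil>\<alpha> * real (Suc i)\<rceil>"
    have "{u \<in> F. length u = Suc i} \<subseteq> {x. \<exists>p. U p = Some x \<and> length p < m}"
      unfolding F_def m_def by (auto simp: less_ceiling_iff zless_nat_eq_int_zless)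
    moreover have "finite {x. \<exists>p. U p = Some x \<and> length p < m}"
      by (rule finite_subset[OF _ finite_imageI[OF finite_lists_length_less[of m], of "the \<circ> U"]])
        force
    ultimately have "card {u \<in> F. length u = Suc i} \<le> 2 ^ m"
      using card_described card_mono le_trans by meson
    then have "real (card {u \<in> F. length u = Suc i}) \<le> 2 ^ m"
      by (metis of_nat_le_iff of_nat_numeral of_nat_power)
    also have "(2 :: real) ^ m = 2 powr real m" by (simp add: powr_realpow)
    also have "\<dots> \<le> 2 powr (\<alpha> * real (Suc i) + 1)"
    proof (rule powr_mono)
      have "0 \<le> \<alpha> * real (Suc i)" using assms(1) by simp
      then show "real m \<le> \<alpha> * real (Suc i) + 1" unfolding m_def by linarith
    qed simp
    also have "\<dots> = 2 * r ^ Suc i"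
      by (simp only: powr_add r_def powr_powr[symmetric] powr_realpow[OF r(1)[unfolded r_def]]) simp
    finally show ?thesis using \<beta>(3) by (simp add: q_def power_divide divide_right_mono mult_ac)
  qed
  have "avoidable F"
  proof (rule avoidable_if_sparse[OF _ \<beta>(3)])
    show "[] \<notin> F" by (simp add: F_def)
    fix n
    \<comment> \<open>Strings in \<open>F\<close> are longer than \<open>N\<close>, so the terms
      with \<open>Suc i \<le> N\<close> vanish.\<close>
    have "real (card {u \<in> F. length u = Suc i}) / \<beta> ^ i \<le> (if N \<le> i then 2 * r * q ^ i else 0)" for i
    proof (cases "N \<le> i")
      case False
      then have none: "{u \<in> F. length u = Suc i} = {}" by (auto simp: F_def)
      show ?thesis using False unfolding none by simp
    qed (use bound in simp)
    then have "(\<Sum>i<n. real (card {u \<in> F. length u = Suc i}) / \<beta> ^ i)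
        \<le> (\<Sum>i<n. if N \<le> i then 2 * r * q ^ i else 0)"
      by (rule sum_mono)
    \<comment> \<open>Enlarging the range leaves exactly the \<open>n\<close> terms from
      \<open>N\<close> on, with no case split on whether \<open>n < N\<close>.\<close>
    also have "\<dots> \<le> (\<Sum>i<N + n. if N \<le> i then 2 * r * q ^ i else 0)"
      using r q by (intro sum_mono2) auto
    also have "\<dots> = (\<Sum>i = N..<N + n. 2 * r * q ^ i)"
      by (rule sum.mono_neutral_cong_right) auto
    also have "\<dots> = (\<Sum>i<n. 2 * r * q ^ N * q ^ i)"
      using sum.shift_bounds_nat_ivl[of "\<lambda>i. 2 * r * q ^ i" 0 N n]
      by (simp add: power_add lessThan_atLeast0 mult_ac add.commute)
    also have "\<dots> = 2 * r * q ^ N * ((1 - q ^ n) / (1 - q))"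
      using q by (simp add: sum_distrib_left[symmetric] sum_gp_strict)
    also have "\<dots> \<le> 2 * r * q ^ N * (1 / (1 - q))"
      using r q by (intro mult_left_mono divide_right_mono) auto
    also have "\<dots> \<le> 2 - \<beta>" using N by simp
    finally show "(\<Sum>i<n. real (card {u \<in> F. length u = Suc i}) / \<beta> ^ i) \<le> real CARD(bool) - \<beta>"
      by simp
  qed
  then show thesis using that unfolding F_def by blast
qed

lemma Kolmogorov_lower_bound:
  assumes "\<And>p. U p = Some x \<Longrightarrow> c \<le> real (length p)"
  shows "ereal c \<le> ereal_of_enat (Kolmogorov U x)"
proof (cases "\<exists>p. U p = Some x")
  case True
  \<comment> \<open>An infimum of a nonempty set of \<open>enat\<close> is its least element, hence
    the length of an actual description.\<close>
  then have "Kolmogorov U x \<in> (\<lambda>p. enat (length p)) ` {p. U p = Some x}"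
    unfolding Kolmogorov_def Inf_enat_def by (auto intro: LeastI)
  then show ?thesis using assms by auto
next
  case False
  then have "Kolmogorov U x = \<infinity>" by (simp add: Kolmogorov_def top_enat_def)
  then show ?thesis by simp
qed

theorem proposition6:
  fixes \<alpha> :: real and U :: machine
  assumes "\<alpha> < 1"
    and "optimal_in computable_machines U \<or> optimal_in prefix_free_machines U"
  shows "\<exists>\<omega> :: bool word. almost_periodic \<omega> \<and>
           (\<exists>N :: nat. \<forall>x. substring_of x \<omega> \<and> length x > N \<longrightarrow>
              ereal (\<alpha> * real (length x)) \<le> ereal_of_enat (Kolmogorov U x))"
proof -
  \<comment> \<open>The counting lemma requires a positive constant below 1; raising
    \<open>\<alpha>\<close> to at least \<open>1/2\<close> only strengthens the bound.\<close>
  define a where "a = max \<alpha> (1/2)"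
  have "0 < a" "a < 1" using assms(1) by (auto simp: a_def)
  then obtain N where
    "avoidable {x. N < length x \<and> (\<exists>p. U p = Some x \<and> real (length p) < a * real (length x))}"
    using avoidable_compressible by blast
  then obtain \<omega> :: "bool word" where "almost_periodic \<omega>"
    and \<omega>: "\<And>x. substring_of x \<omega> \<Longrightarrow>
      x \<notin> {x. N < length x \<and> (\<exists>p. U p = Some x \<and> real (length p) < a * real (length x))}"
    using almost_periodic_avoiding by blast
  moreover have "ereal (\<alpha> * real (length x)) \<le> ereal_of_enat (Kolmogorov U x)"
    if "substring_of x \<omega>" "N < length x" for x
  proof (rule Kolmogorov_lower_bound)
    fix p assume "U p = Some x"
    then have "a * real (length x) \<le> real (length p)" using \<omega>[OF that(1)] that(2) by force
    moreover have "\<alpha> * real (length x) \<le> a * real (length x)"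
      by (intro mult_right_mono) (auto simp: a_def)
    ultimately show "\<alpha> * real (length x) \<le> real (length p)" by linarith
  qed
  ultimately show ?thesis by blast
qed

end
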